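(* Let $d\ge 2$, let $K\subseteq\mathbb{R}^d$ be a convex body, and let $k$ be a positive integer with $k\le d(\ln d+\ln\ln d)$. Then \[\vartheta^{(k)}(K)\le 6ed(3\ln d+\ln\ln d+15).\]
   Context: A convex body is a compact convex subset of $\mathbb{R}^d$ with nonempty interior. A $k$-fold covering of $\mathbb{R}^d$ is a family of sets such that every point of $\mathbb{R}^d$ belongs to at least $k$ of them (counted with multiplicity). Its density is $\limsup_{r\to\infty}\frac{\sum_{i:\,C_i\subseteq rB}\operatorname{vol}(C_i)}{\operatorname{vol}(rB)}$, $B$ the Euclidean unit ball. $\vartheta^{(k)}(K)$ denotes the infimum of the densities of $k$-fold coverings of $\mathbb{R}^d$ by translates of $K$. *)

theory Defs
  imports "HOL-Analysis.Analysis"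
begin

definition convex_body :: "'a::euclidean_space set \<Rightarrow> bool" where
  "convex_body K \<longleftrightarrow> compact K \<and> convex K \<and> interior K \<noteq> {}"

definition translate :: "'a::euclidean_space \<Rightarrow> 'a set \<Rightarrow> 'a set" where
  "translate t K = (\<lambda>x. t + x) ` K"

text \<open>A family of translates of K, indexed by nat (with repetitions allowed),
  is a k-fold covering if every point lies in at least k members (counted with multiplicity).\<close>
definition kfold_translative_covering ::
    "nat \<Rightarrow> 'a::euclidean_space set \<Rightarrow> (nat \<Rightarrow> 'a) \<Rightarrow> bool" where
  "kfold_translative_covering k K t \<longleftrightarrow>
     (\<forall>x. \<exists>F. F \<subseteq> {i. x \<in> translate (t i) K} \<and> finite F \<and> card F = k)"

definition count_inside :: "'a::euclidean_space set \<Rightarrow> (nat \<Rightarrow> 'a) \<Rightarrow> real \<Rightarrow> ereal" where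
  "count_inside K t r =
     (let S = {i. translate (t i) K \<subseteq> cball 0 r} in
      if finite S then ereal (real (card S)) else \<infinity>)"

definition translative_density :: "'a::euclidean_space set \<Rightarrow> (nat \<Rightarrow> 'a) \<Rightarrow> ereal" where
  "translative_density K t =
     Limsup at_top (\<lambda>r::real. count_inside K t r * ereal (measure lborel K)
                               / ereal (measure lborel (cball (0::'a) r)))"

definition kfold_covering_density :: "nat \<Rightarrow> 'a::euclidean_space set \<Rightarrow> ereal" where
  "kfold_covering_density k K =
     Inf {translative_density K t | t. kfold_translative_covering k K t}"

end

theory Submission
  imports Defs
begin

text \<open>Choose the origin of K so that \<open>S = K \<inter> - K\<close> has volume at least \<open>3\<^sup>-\<^sup>d vol K\<close>, and put
  \<open>\<delta> = 1 / (2 d)\<close>. If N is a \<open>\<delta> S\<close>-net of a large cube, then translates of \<open>(1 - \<delta>) K\<close> that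
  cover every point of N at least k times give, after enlarging them to K, a k-fold covering of the
  cube. A derandomised uniform choice of translates, with weight \<open>2\<^sup>-\<^sup>c\<close> on a net point covered c times,
  leaves so few net points covered less than k times that k further copies of K at each of
  them cost a density of at most 2. The covering of the cube is then extended periodically.\<close>

section \<open>Volume bounds: packings and reflected overlaps\<close>

text \<open>Volumes of disjoint translates add up. This is proved first for finite subsets of
  \<open>X\<close>; their sizes are thereby uniformly bounded, which yields finiteness of
  \<open>X\<close>. It serves both for separated nets and for counting lattice cells in a
  ball.\<close>

lemma packing_card_le:
  fixes C :: "'a::euclidean_space set"
  assumes C: "C \<in> lmeasurable" "0 < measure lebesgue C" and B: "B \<in> lmeasurable"
    and sub: "\<And>x. x \<in> X \<Longrightarrow> (+) x ` C \<subseteq> B"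
    and disj: "pairwise (\<lambda>x y. disjnt ((+) x ` C) ((+) y ` C)) X"
  shows "finite X \<and> real (card X) * measure lebesgue C \<le> measure lebesgue B"
proof -
  have fin: "real (card G) * measure lebesgue C \<le> measure lebesgue B" if "G \<subseteq> X" "finite G" for G
  proof -
    have "measure lebesgue (\<Union>x\<in>G. (+) x ` C) = (\<Sum>x\<in>G. measure lebesgue ((+) x ` C))"
      using that disj C by (intro measure_UNION') (auto intro: measurable_translation pairwise_subset)
    then have "real (card G) * measure lebesgue C = measure lebesgue (\<Union>x\<in>G. (+) x ` C)"
      by (simp add: measure_translation)
    also have "\<dots> \<le> measure lebesgue B"
      using that sub C B by (intro measure_mono_fmeasurable) (auto intro!: sets.finite_UN fmeasurableD measurable_translation)
    finally show ?thesis .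
  qed
  have "card G \<le> nat \<lfloor>measure lebesgue B / measure lebesgue C\<rfloor>" if "G \<subseteq> X" "finite G" for G
    using fin[OF that] C(2) by (simp add: le_nat_floor field_simps)
  then have "finite X"
    using finite_if_finite_subsets_card_bdd by blast
  with fin show ?thesis by blast
qed

text \<open>The overlap integrates to \<open>(vol K)\<^sup>2\<close> over a, and it vanishes for a outside \<open>2 K\<close>.\<close>

lemma exists_large_reflection_overlap:
  fixes K :: "'a::euclidean_space set"
  assumes K: "compact K" "convex K" and pos: "0 < measure lebesgue K"
  shows "\<exists>a. measure lebesgue K \<le> 3 ^ DIM('a) * measure lebesgue (K \<inter> (\<lambda>x. a - x) ` K)"
proof (rule ccontr)
  assume "\<not> ?thesis"
  then have less: "3 ^ DIM('a) * measure lebesgue (K \<inter> (\<lambda>x. a - x) ` K) < measure lebesgue K" for a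
    by (meson not_le)
  define v where "v = measure lebesgue K"
  have Kb[measurable]: "K \<in> sets borel" using K by (simp add: borel_compact)
  have emK: "emeasure lborel K = ennreal v"
    using fmeasurable_compact[OF K(1)] Kb by (simp add: v_def emeasure_eq_measure2)
  have shift: "(\<integral>\<^sup>+x. indicator K (x - y) \<partial>lborel) = ennreal v" for y :: 'a
  proof -
    have "(\<integral>\<^sup>+x. indicator K (x - y) \<partial>lborel)
        = (\<integral>\<^sup>+x. indicator K (x - y) \<partial>(distr lborel borel ((+) y)))"
      by (simp add: lborel_distr_plus)
    also have "\<dots> = ennreal v"
      by (subst nn_integral_distr) (auto simp: emK)
    finally show ?thesis .
  qed
  have cpt: "compact (K \<inter> (\<lambda>y. x - y) ` K)" for x
    using K by (intro compact_Int compact_continuous_image continuous_intros) auto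
  have em: "(\<integral>\<^sup>+y. indicator K y * indicator K (x - y) \<partial>lborel)
      = ennreal (measure lebesgue (K \<inter> (\<lambda>y. x - y) ` K))" for x
  proof -
    have "(\<integral>\<^sup>+y. indicator K y * indicator K (x - y) \<partial>lborel)
        = (\<integral>\<^sup>+y. indicator (K \<inter> (\<lambda>y. x - y) ` K) y \<partial>lborel)"
      by (rule nn_integral_cong) (auto simp: indicator_def image_iff algebra_simps)
    also have "\<dots> = emeasure lborel (K \<inter> (\<lambda>y. x - y) ` K)"
      using cpt[of x] by (simp add: borel_compact)
    also have "\<dots> = ennreal (measure lebesgue (K \<inter> (\<lambda>y. x - y) ` K))"
      using fmeasurable_compact[OF cpt[of x]] borel_compact[OF cpt[of x]]
      by (simp add: emeasure_eq_measure2)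
    finally show ?thesis .
  qed
  \<comment> \<open>The set \<open>2 K\<close>; the summand \<open>+ 0\<close> matches the affine
    form in \<open>measure_lebesgue_affine\<close>. If \<open>y\<close> and \<open>x - y\<close> lie
    in \<open>K\<close>, then so does their midpoint \<open>x / 2\<close>.\<close>
  let ?D = "(\<lambda>x. 2 *\<^sub>R x + 0) ` K"
  have cD: "compact ?D"
    using K by (intro compact_continuous_image continuous_intros) auto
  have mD: "emeasure lborel ?D = ennreal (2 ^ DIM('a) * v)"
    using fmeasurable_compact[OF cD] borel_compact[OF cD] measure_lebesgue_affine[of 2 0 K]
    by (simp add: emeasure_eq_measure2 v_def)
  have supp: "indicator K y * indicator K (x - y) \<le> (indicator ?D x :: ennreal)" for x y
  proof -
    have "x \<in> ?D" if "y \<in> K" "x - y \<in> K"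
    proof -
      have "(1/2) *\<^sub>R y + (1/2) *\<^sub>R (x - y) \<in> K"
        using that K(2) by (intro convexD) auto
      then have "(1/2) *\<^sub>R x \<in> K" by (simp add: algebra_simps)
      then show ?thesis by (intro image_eqI[of _ _ "(1/2) *\<^sub>R x"]) auto
    qed
    then show ?thesis by (auto simp: indicator_def)
  qed
  \<comment> \<open>The overlap is integrated in both orders. The averaging alone gives base 2; with
    base 3, a non-strict comparison of integrals already contradicts
    \<open>2 ^ DIM('a) < 3 ^ DIM('a)\<close>.\<close>
  have "ennreal v * ennreal v = (\<integral>\<^sup>+y. \<integral>\<^sup>+x. indicator K y * indicator K (x - y) \<partial>lborel \<partial>lborel)"
    by (simp add: nn_integral_cmult shift nn_integral_multc emK)
  also have "\<dots> = (\<integral>\<^sup>+x. \<integral>\<^sup>+y. indicator K y * indicator K (x - y) \<partial>lborel \<partial>lborel)"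
    by (rule lborel_pair.Fubini') measurable
  also have "\<dots> \<le> (\<integral>\<^sup>+x. ennreal (v / 3 ^ DIM('a)) * indicator ?D x \<partial>lborel)"
  proof (rule nn_integral_mono)
    fix x :: 'a
    show "(\<integral>\<^sup>+y. indicator K y * indicator K (x - y) \<partial>lborel) \<le> ennreal (v / 3 ^ DIM('a)) * indicator ?D x"
    proof (cases "x \<in> ?D")
      case True
      then show ?thesis
        using less[of x] unfolding em by (auto simp: v_def field_simps intro!: ennreal_leI)
    next
      case False
      then have "(\<lambda>y. indicator K y * indicator K (x - y) :: ennreal) = (\<lambda>y. 0)"
        using supp[of _ x] by (auto simp: fun_eq_iff)
      then show ?thesis by simp
    qed
  qed
  also have "\<dots> = ennreal (v / 3 ^ DIM('a) * (2 ^ DIM('a) * v))"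
    using borel_compact[OF cD]
    by (subst nn_integral_cmult_indicator, simp)
       (subst mD, rule ennreal_mult[symmetric], auto simp: v_def)
  finally have "v * v \<le> v / 3 ^ DIM('a) * (2 ^ DIM('a) * v)"
    using pos by (simp add: v_def flip: ennreal_mult)
  then have "3 ^ DIM('a) \<le> (2::real) ^ DIM('a)"
    using pos by (simp add: v_def field_simps)
  moreover have "(2::real) ^ DIM('a) < 3 ^ DIM('a)"
    by (intro power_strict_mono) auto
  ultimately show False by simp
qed

section \<open>Averaging over translates, nets, and k-fold covers of finite sets\<close>

text \<open>A point \<open>n\<close> is covered by \<open>t + C\<close> exactly for \<open>t\<close>
  in \<open>n - C\<close>, a subset of \<open>B\<close> with the volume of \<open>C\<close>.
  Integrating the covered weight over \<open>t\<close> therefore gives the volume of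
  \<open>C\<close> times the total weight, and some \<open>t\<close> attains at least the mean over
  \<open>B\<close>.\<close>

lemma exists_translate_ge_average:
  fixes C :: "'a::euclidean_space set" and w :: "'a \<Rightarrow> real"
  assumes "finite N" and C: "compact C" and B: "B \<in> lmeasurable" "0 < measure lebesgue B"
    and w: "\<And>n. n \<in> N \<Longrightarrow> 0 \<le> w n"
    and sub: "\<And>n c. n \<in> N \<Longrightarrow> c \<in> C \<Longrightarrow> n - c \<in> B"
  shows "\<exists>t. measure lebesgue C / measure lebesgue B * (\<Sum>n\<in>N. w n) \<le> (\<Sum>n\<in>{n\<in>N. n - t \<in> C}. w n)"
proof -
  define f where "f t = (\<Sum>n\<in>{n\<in>N. n - t \<in> C}. w n)" for t
  \<comment> \<open>All values of \<open>f\<close> are subset sums of \<open>w\<close>, so a maximum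
    exists without any continuity argument.\<close>
  have fin: "finite (range f)"
  proof (rule finite_subset)
    show "range f \<subseteq> (\<lambda>A. sum w A) ` Pow N" by (auto simp: f_def)
  qed (use \<open>finite N\<close> in auto)
  obtain t where t: "f s \<le> f t" for s
    using Max_in[OF fin] Max_ge[OF fin] by (metis empty_is_image image_iff rangeI UNIV_not_empty)
  have refl: "(\<lambda>x. -1 *\<^sub>R x + n) ` C \<in> lmeasurable" for n
    using C by (intro lmeasurable_compact compact_continuous_image continuous_intros) auto
  have f_eq: "f s = (\<Sum>n\<in>N. w n * indicator ((\<lambda>x. -1 *\<^sub>R x + n) ` C) s)" for s
  proof -
    have "s \<in> (\<lambda>x. -1 *\<^sub>R x + n) ` C \<longleftrightarrow> n - s \<in> C" for n
      by (auto simp: image_iff algebra_simps intro: bexI[of _ "n - s"])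
    then show ?thesis
      unfolding f_def sum.inter_filter[OF \<open>finite N\<close>] indicator_def by (intro sum.cong) simp_all
  qed
  have "(\<Sum>n\<in>N. w n) * measure lebesgue C = (\<Sum>n\<in>N. w n * measure lebesgue ((\<lambda>x. -1 *\<^sub>R x + n) ` C))"
    unfolding measure_lebesgue_affine by (simp add: sum_distrib_right)
  also have "\<dots> = (\<integral>s. f s \<partial>lebesgue)"
    unfolding f_eq using refl by (subst Bochner_Integration.integral_sum) (auto simp: lmeasurable_iff_integrable)
  also have "\<dots> \<le> (\<integral>s. f t * indicator B s \<partial>lebesgue)"
  proof (rule integral_mono)
    show "integrable lebesgue f"
      unfolding f_eq[abs_def] using refl by (auto simp: lmeasurable_iff_integrable)
    show "integrable lebesgue (\<lambda>s. f t * indicator B s)"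
      using B by (auto simp: fmeasurable_def less_top[symmetric])
    fix s
    show "f s \<le> f t * indicator B s"
    proof (cases "s \<in> B")
      case False
      then have "{n\<in>N. n - s \<in> C} = {}"
        using sub by force
      then have "f s = 0"
        unfolding f_def by (simp only: sum.empty)
      then show ?thesis using False by simp
    qed (use t in auto)
  qed
  also have "\<dots> = f t * measure lebesgue B" using B by simp
  finally show ?thesis
    using B(2) by (intro exI[of _ t]) (simp add: f_def field_simps)
qed

text \<open>A largest subset of \<open>Q\<close> with no two points differing by an element of
  \<open>T\<close> is a net, since an uncovered point could be added. The half-size copies of
  \<open>T\<close> at its points form a packing in \<open>B\<close>, hence the factor
  \<open>2 ^ DIM('a)\<close>.\<close>

lemma exists_maximal_separated_net:
  fixes T :: "'a::euclidean_space set"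
  assumes T: "compact T" "convex T" "0 < measure lebesgue T" and symm: "\<And>x. x \<in> T \<Longrightarrow> - x \<in> T"
    and B: "B \<in> lmeasurable" and sub: "\<And>q s. q \<in> Q \<Longrightarrow> s \<in> T \<Longrightarrow> q + (1/2) *\<^sub>R s \<in> B"
  shows "\<exists>N\<subseteq>Q. finite N \<and> real (card N) * measure lebesgue T \<le> 2 ^ DIM('a) * measure lebesgue B \<and>
    (\<forall>q\<in>Q. \<exists>n\<in>N. q - n \<in> T)"
proof -
  define sep where "sep X \<longleftrightarrow> X \<subseteq> Q \<and> pairwise (\<lambda>x y. x - y \<notin> T) X" for X
  let ?H = "(\<lambda>x. (1/2) *\<^sub>R x + 0) ` T"
  have mH: "measure lebesgue ?H = measure lebesgue T / 2 ^ DIM('a)"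
    unfolding measure_lebesgue_affine by (simp add: power_one_over)
  have bound: "finite X \<and> real (card X) * measure lebesgue T \<le> 2 ^ DIM('a) * measure lebesgue B"
    if "sep X" for X
  proof -
    have "finite X \<and> real (card X) * measure lebesgue ?H \<le> measure lebesgue B"
    proof (rule packing_card_le)
      show "?H \<in> lmeasurable"
        using T by (intro lmeasurable_compact compact_continuous_image continuous_intros) auto
      show "pairwise (\<lambda>x y. disjnt ((+) x ` ?H) ((+) y ` ?H)) X"
      proof (rule pairwiseI)
        fix x y assume xy: "x \<in> X" "y \<in> X" "x \<noteq> y"
        \<comment> \<open>A common point of two half-size copies would make \<open>x - y\<close> the
          midpoint of \<open>t\<close> and \<open>- s\<close>, hence an element of
          \<open>T\<close>.\<close>
        have False if "s \<in> T" "t \<in> T" "x + (1/2) *\<^sub>R s = y + (1/2) *\<^sub>R t" for s t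
        proof -
          have "(1/2) *\<^sub>R t + (1/2) *\<^sub>R (- s) \<in> T"
            using that T(2) symm by (intro convexD) auto
          moreover have "x - y = (1/2) *\<^sub>R t + (1/2) *\<^sub>R (- s)"
            using that(3) by (simp add: algebra_simps)
          ultimately show False
            using xy \<open>sep X\<close> unfolding sep_def pairwise_def by metis
        qed
        then show "disjnt ((+) x ` ?H) ((+) y ` ?H)"
          by (auto simp: disjnt_iff)
      qed
    qed (use that sub T(3) B mH in \<open>auto simp: sep_def\<close>)
    then show ?thesis unfolding mH by (simp add: field_simps)
  qed
  \<comment> \<open>The packing bound caps all cardinalities, so a separated set of greatest size
    exists.\<close>
  have "card X < Suc (nat \<lfloor>2 ^ DIM('a) * measure lebesgue B / measure lebesgue T\<rfloor>)" if "sep X" for X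
    using bound[OF that] T(3) by (simp add: le_nat_floor field_simps less_Suc_eq_le)
  moreover have "sep {}" by (simp add: sep_def)
  ultimately obtain N where N: "sep N" and max: "\<And>X. sep X \<Longrightarrow> card X \<le> card N"
    using ex_has_greatest_nat[of sep "{}" card] by blast
  \<comment> \<open>This ensures that an uncovered \<open>q\<close> is not already in
    \<open>N\<close>, so that inserting it increases the cardinality.\<close>
  have "0 \<in> T"
  proof -
    obtain x where "x \<in> T" using T(3) by fastforce
    then have "(1/2) *\<^sub>R x + (1/2) *\<^sub>R (- x) \<in> T"
      using T(2) symm by (intro convexD) auto
    then show ?thesis by simp
  qed
  have "\<exists>n\<in>N. q - n \<in> T" if "q \<in> Q" for q
  proof (rule ccontr)
    assume "\<not> ?thesis"
    then have far: "q - n \<notin> T" "n - q \<notin> T" if "n \<in> N" for n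
      using that symm[of "n - q"] by auto
    then have "q \<notin> N" using \<open>0 \<in> T\<close> by force
    moreover have "sep (insert q N)"
      using N far \<open>q \<in> Q\<close> by (auto simp: sep_def pairwise_insert)
    ultimately show False
      using max[of "insert q N"] bound[OF N] by simp
  qed
  then show ?thesis
    using bound[OF N] N by (intro exI[of _ N]) (auto simp: sep_def)
qed

text \<open>The weights halve on the points covered by the next translate, so by averaging some translate
  reduces the total weight by the factor \<open>1 - p / 2\<close>, where p is the volume ratio of C and B.\<close>

lemma exists_low_weight_translates:
  fixes C :: "'a::euclidean_space set"
  assumes "finite N" "compact C" and B: "B \<in> lmeasurable" "0 < measure lebesgue B"
    and le: "measure lebesgue C \<le> measure lebesgue B"
    and sub: "\<And>n c. n \<in> N \<Longrightarrow> c \<in> C \<Longrightarrow> n - c \<in> B"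
  shows "\<exists>ts. length ts = M \<and> (\<Sum>n\<in>N. (1/2) ^ length (filter (\<lambda>t. n - t \<in> C) ts))
    \<le> (1 - measure lebesgue C / measure lebesgue B / 2) ^ M * real (card N)"
proof (induction M)
  case 0
  then show ?case by simp
next
  case (Suc M)
  let ?p = "measure lebesgue C / measure lebesgue B"
  from Suc obtain ts where ts: "length ts = M"
    and IH: "(\<Sum>n\<in>N. (1/2) ^ length (filter (\<lambda>t. n - t \<in> C) ts)) \<le> (1 - ?p / 2) ^ M * real (card N)"
    by blast
  define w :: "'a \<Rightarrow> real" where "w n = (1/2) ^ length (filter (\<lambda>t. n - t \<in> C) ts)" for n
  obtain t where t: "?p * (\<Sum>n\<in>N. w n) \<le> (\<Sum>n\<in>{n\<in>N. n - t \<in> C}. w n)"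
    using exists_translate_ge_average[OF \<open>finite N\<close> \<open>compact C\<close> B, of w] sub by (auto simp: w_def)
  \<comment> \<open>Makes \<open>1 - ?p / 2\<close> nonnegative, so that the induction hypothesis
    may be multiplied by it.\<close>
  have "?p \<le> 1" using le B(2) by simp
  have "(\<Sum>n\<in>N. (1/2) ^ length (filter (\<lambda>t. n - t \<in> C) (t # ts)))
      = (\<Sum>n\<in>N. w n - 1/2 * (if n - t \<in> C then w n else 0))"
    by (intro sum.cong) (auto simp: w_def)
  also have "\<dots> = (\<Sum>n\<in>N. w n) - 1/2 * (\<Sum>n\<in>{n\<in>N. n - t \<in> C}. w n)"
    unfolding sum.inter_filter[OF \<open>finite N\<close>] by (simp only: sum_subtractf sum_distrib_left)
  also have "\<dots> \<le> (1 - ?p / 2) * (\<Sum>n\<in>N. w n)"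
    using t by (simp add: algebra_simps)
  also have "\<dots> \<le> (1 - ?p / 2) * ((1 - ?p / 2) ^ M * real (card N))"
    using IH \<open>?p \<le> 1\<close> by (intro mult_left_mono) (auto simp: w_def)
  finally show ?case
    using ts by (intro exI[of _ "t # ts"]) (simp add: mult.assoc)
qed

text \<open>Markov's inequality applied to the final weights bounds the number of deficient points
  by \<open>2 ^ k\<close> times the total weight; each of them is then repaired separately. The
  number \<open>M\<close> of averaging rounds stays free, to be balanced against the repairs
  later.\<close>

lemma exists_kfold_cover_of_finite_set:
  fixes C :: "'a::euclidean_space set"
  assumes "finite N" "compact C" and B: "B \<in> lmeasurable" "0 < measure lebesgue B"
    and le: "measure lebesgue C \<le> measure lebesgue B"
    and sub: "\<And>n c. n \<in> N \<Longrightarrow> c \<in> C \<Longrightarrow> n - c \<in> B" and "0 \<in> C"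
  shows "\<exists>ts. (\<forall>n\<in>N. k \<le> length (filter (\<lambda>t. n - t \<in> C) ts)) \<and>
    real (length ts) \<le> real M + real k * 2 ^ k *
      (1 - measure lebesgue C / measure lebesgue B / 2) ^ M * real (card N)"
proof -
  let ?W = "(1 - measure lebesgue C / measure lebesgue B / 2) ^ M * real (card N)"
  obtain ts where ts: "length ts = M"
    and W: "(\<Sum>n\<in>N. (1/2) ^ length (filter (\<lambda>t. n - t \<in> C) ts)) \<le> ?W"
    using exists_low_weight_translates[OF assms(1-6)] by blast
  \<comment> \<open>a point covered less than k times still carries weight at least \<open>2\<^sup>-\<^sup>k\<close>\<close>
  define bad where "bad = {n\<in>N. length (filter (\<lambda>t. n - t \<in> C) ts) < k}"
  have "finite bad" using \<open>finite N\<close> by (simp add: bad_def)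
  then obtain bs where bs: "set bs = bad" "distinct bs"
    using finite_distinct_list by blast
  have "real (card bad) * (1/2) ^ k = (\<Sum>n\<in>bad. (1/2) ^ k)" by simp
  also have "\<dots> \<le> (\<Sum>n\<in>bad. (1/2) ^ length (filter (\<lambda>t. n - t \<in> C) ts))"
    by (intro sum_mono power_decreasing) (auto simp: bad_def)
  also have "\<dots> \<le> (\<Sum>n\<in>N. (1/2) ^ length (filter (\<lambda>t. n - t \<in> C) ts))"
    using \<open>finite N\<close> by (intro sum_mono2) (auto simp: bad_def)
  finally have bad: "real (card bad) \<le> 2 ^ k * ?W"
    using mult_left_mono[OF order_trans[OF _ W], of "real (card bad) * (1/2) ^ k" "2 ^ k"]
    by (simp add: power_one_over)
  \<comment> \<open>Each deficient point \<open>n\<close> receives \<open>k\<close> copies with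
    translation vector \<open>n\<close>, which cover it because \<open>0 \<in> C\<close>.\<close>
  define us where "us = ts @ concat (map (replicate k) bs)"
  have "k \<le> length (filter (\<lambda>t. n - t \<in> C) us)" if "n \<in> N" for n
  proof (cases "n \<in> bad")
    case True
    then obtain ys zs where "bs = ys @ n # zs"
      using bs by (metis split_list)
    then show ?thesis using \<open>0 \<in> C\<close> by (simp add: us_def)
  next
    case False
    then show ?thesis using that by (simp add: us_def bad_def)
  qed
  moreover have "length us = M + k * card bad"
    using ts bs by (simp add: us_def length_concat comp_def sum_list_triv distinct_card[symmetric])
  then have "real (length us) \<le> real M + real k * (2 ^ k * ?W)"
    using mult_left_mono[OF bad, of "real k"] by simp
  ultimately show ?thesis
    by (intro exI[of _ us]) (simp add: mult.assoc)
qed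

section \<open>k-fold covers of a large cube\<close>

lemma lmeasure_cube:
  assumes "l \<le> u"
  shows "measure lebesgue (cbox (l *\<^sub>R One) (u *\<^sub>R One) :: 'a::euclidean_space set) = (u - l) ^ DIM('a)"
proof -
  have "measure lebesgue (cbox (l *\<^sub>R One) (u *\<^sub>R One) :: 'a set)
      = (\<Prod>i\<in>(Basis :: 'a set). (u *\<^sub>R One) \<bullet> i - (l *\<^sub>R One) \<bullet> i)"
    using assms by (subst measure_completion, simp) (rule content_cbox[rule_format], simp)
  also have "\<dots> = (\<Prod>i\<in>(Basis :: 'a set). u - l)"
    by (intro prod.cong) simp_all
  finally show ?thesis by simp
qed

text \<open>The core construction, with \<open>K\<close> already positioned so that its symmetric
  part is large. Copies of \<open>(1 - \<delta>) K\<close> cover a net, and the slack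
  \<open>\<delta> K\<close> carries the cover over to the whole cube. The final factor is
  \<open>4 * \<mu> + 4\<close> for the \<open>\<mu>\<close> of the proof.\<close>

lemma exists_kfold_cover_of_cube_centred:
  fixes K :: "'a::euclidean_space set"
  assumes K: "compact K" "convex K" "0 < measure lebesgue K"
    and overlap: "measure lebesgue K \<le> 3 ^ DIM('a) * measure lebesgue (K \<inter> uminus ` K)"
    and "1 \<le> k"
  shows "\<exists>L>0. \<exists>ts. (\<forall>x\<in>cbox 0 (L *\<^sub>R One). k \<le> length (filter (\<lambda>t. x - t \<in> K) ts)) \<and>
    real (length ts) * measure lebesgue K \<le> L ^ DIM('a) *
      (8 * (real DIM('a) * ln (12 * real DIM('a)) + real k * ln 2 + ln (real k)) + 4)"
proof -
  define d where "d = real DIM('a)"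
  have d1: "1 \<le> d" using DIM_positive[where 'a='a] unfolding d_def by linarith
  \<comment> \<open>Bernoulli's inequality gives \<open>(1 - \<delta>) ^ DIM('a) \<ge> 1/2\<close>,
    so shrinking at most halves the volume. The resulting fineness of the net enters the final bound
    only through a logarithm.\<close>
  define \<delta> where "\<delta> = 1 / (2 * d)"
  have \<delta>: "0 < \<delta>" "\<delta> \<le> 1/2" using d1 by (auto simp: \<delta>_def field_simps)
  define S where "S = K \<inter> uminus ` K"
  define v where "v = measure lebesgue K"
  have S: "compact S" "convex S" "\<And>x. x \<in> S \<Longrightarrow> - x \<in> S"
    unfolding S_def using K by (simp_all add: compact_Int convex_Int compact_negations convex_negations) auto
  have vS: "v \<le> 3 ^ DIM('a) * measure lebesgue S" and v0: "0 < v"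
    using overlap K by (auto simp: S_def v_def)
  have mS: "0 < measure lebesgue S"
    using vS v0 by (simp add: zero_less_measure_iff) (metis less_irrefl mult_zero_right not_less order.strict_trans2)
  have "0 \<in> K"
  proof -
    obtain x where "x \<in> S" using mS by fastforce
    then have "(1/2) *\<^sub>R x + (1/2) *\<^sub>R (- x) \<in> K"
      using K(2) by (intro convexD) (auto simp: S_def)
    then show ?thesis by simp
  qed
  obtain R where R: "R > 0" "\<And>x. x \<in> K \<Longrightarrow> norm x \<le> R"
    using compact_imp_bounded[OF K(1)] unfolding bounded_pos by blast
  have RK: "\<bar>x \<bullet> i\<bar> \<le> R" if "x \<in> K" "i \<in> Basis" for x i
    using R(2)[OF that(1)] Basis_le_norm[OF that(2), of x] by linarith
  have shrink: "\<bar>c * (x \<bullet> i)\<bar> \<le> R" if "x \<in> K" "i \<in> Basis" "0 \<le> c" "c \<le> 1" for x i c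
  proof -
    have "\<bar>c * (x \<bullet> i)\<bar> \<le> 1 * R"
      unfolding abs_mult using that RK[OF that(1,2)] by (intro mult_mono) auto
    then show ?thesis by simp
  qed
  \<comment> \<open>With this choice \<open>L + 2 * R = L * (1 + 1 / (2 * d))\<close>, so the cube
    \<open>B\<close>, which is \<open>Q\<close> widened by \<open>R\<close> on every side, has at
    most \<open>exp (1/2) \<le> 2\<close> times the volume of \<open>Q\<close>.\<close>
  define L where "L = 4 * d * R"
  have L: "L > 0" using d1 R by (simp add: L_def)
  define Q :: "'a set" where "Q = cbox 0 (L *\<^sub>R One)"
  define B :: "'a set" where "B = cbox ((- R) *\<^sub>R One) ((L + R) *\<^sub>R One)"
  define V where "V = measure lebesgue B"
  have V: "V = (L + 2 * R) ^ DIM('a)"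
    using L R unfolding V_def B_def by (subst lmeasure_cube) (auto simp: algebra_simps)
  have Bm: "B \<in> lmeasurable" by (simp add: B_def)
  have V0: "V > 0" using V L R by simp
  have QB: "q + x \<in> B" if "q \<in> Q" "\<And>i. i \<in> Basis \<Longrightarrow> \<bar>x \<bullet> i\<bar> \<le> R" for q x
  proof -
    have "- R \<le> (q + x) \<bullet> i \<and> (q + x) \<bullet> i \<le> L + R" if i: "i \<in> Basis" for i
    proof -
      have "0 \<le> q \<bullet> i" "q \<bullet> i \<le> L" using \<open>q \<in> Q\<close> i by (auto simp: Q_def mem_box)
      with \<open>\<And>i. i \<in> Basis \<Longrightarrow> \<bar>x \<bullet> i\<bar> \<le> R\<close>[OF i] show ?thesis
        unfolding inner_add_left by linarith
    qed
    then show ?thesis by (simp add: B_def mem_box)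
  qed
  have "V = L ^ DIM('a) * (1 + (1/2) / d) ^ DIM('a)"
  proof -
    have "L + 2 * R = L * (1 + (1/2) / d)" using d1 by (simp add: L_def field_simps)
    then show ?thesis unfolding V by (simp only: power_mult_distrib)
  qed
  also have "\<dots> \<le> L ^ DIM('a) * exp (1/2)"
    using L exp_ge_one_plus_x_over_n_power_n[of "DIM('a)" "1/2"] by (intro mult_left_mono) (auto simp: d_def)
  also have "\<dots> \<le> L ^ DIM('a) * 2"
    using L exp_half_le2 by (intro mult_left_mono) auto
  finally have VL: "V \<le> 2 * L ^ DIM('a)" by simp

  define T where "T = (\<lambda>x. \<delta> *\<^sub>R x + 0) ` S"
  define C where "C = (\<lambda>x. (1 - \<delta>) *\<^sub>R x + 0) ` K"
  have mT: "measure lebesgue T = \<delta> ^ DIM('a) * measure lebesgue S"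
    unfolding T_def measure_lebesgue_affine using \<delta> by simp
  have mC: "measure lebesgue C = (1 - \<delta>) ^ DIM('a) * v"
    unfolding C_def measure_lebesgue_affine v_def using \<delta> by simp
  have T: "compact T" "convex T" "0 < measure lebesgue T" and C: "compact C" "0 \<in> C"
    using S K(1) \<delta> mS \<open>0 \<in> K\<close> unfolding mT
    by (auto simp: T_def C_def intro!: compact_scaling convex_scaling)
  have T_symm: "- x \<in> T" if xT: "x \<in> T" for x
  proof -
    obtain s where "s \<in> S" "x = \<delta> *\<^sub>R s" using xT by (auto simp: T_def)
    then show ?thesis using S(3)[of s] by (auto simp: T_def intro!: image_eqI[of _ _ "- s"])
  qed
  have CR: "\<bar>c \<bullet> i\<bar> \<le> R" if "c \<in> C" "i \<in> Basis" for c i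
    using that shrink[of _ i "1 - \<delta>"] \<delta> by (auto simp: C_def)
  have TR: "\<bar>((1/2) *\<^sub>R c) \<bullet> i\<bar> \<le> R" if "c \<in> T" "i \<in> Basis" for c i
    using that shrink[of _ i "1/2 * \<delta>"] \<delta> by (auto simp: T_def S_def)
  have zQ: "0 \<in> Q" using L by (auto simp: Q_def mem_box)
  have "K \<subseteq> B" using QB[OF zQ] RK by fastforce
  then have vV: "v \<le> V"
    unfolding v_def V_def using K Bm by (intro measure_mono_fmeasurable) (auto simp: lmeasurable_compact fmeasurableD)
  have "measure lebesgue C \<le> v"
    unfolding mC using \<delta> v0 by (simp add: mult_le_cancel_right1 power_le_one)
  then have CB: "measure lebesgue C \<le> measure lebesgue B" using vV by (simp add: V_def)
  have "\<exists>N\<subseteq>Q. finite N \<and> real (card N) * measure lebesgue T \<le> 2 ^ DIM('a) * V \<and>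
      (\<forall>q\<in>Q. \<exists>n\<in>N. q - n \<in> T)"
    unfolding V_def by (rule exists_maximal_separated_net[OF T T_symm Bm]) (assumption, intro QB TR)
  then obtain N where N: "N \<subseteq> Q" "finite N"
    and cardN: "real (card N) * measure lebesgue T \<le> 2 ^ DIM('a) * V"
    and net: "\<forall>q\<in>Q. \<exists>n\<in>N. q - n \<in> T"
    by (elim exE conjE)
  \<comment> \<open>The base \<open>12 * d\<close> is the product of 3 from the symmetric part, 2
    from the half-size packing and \<open>2 * d\<close> from \<open>\<delta>\<close>.\<close>
  have cardN': "real (card N) * v \<le> V * (12 * d) ^ DIM('a)"
  proof -
    have "real (card N) * v \<le> real (card N) * (3 ^ DIM('a) * measure lebesgue S)"
      using vS by (intro mult_left_mono) auto
    also have "\<dots> = (6 * d) ^ DIM('a) * (real (card N) * measure lebesgue T)"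
    proof -
      have "6 * d * \<delta> = 3" using d1 by (simp add: \<delta>_def)
      then have "(3::real) ^ DIM('a) = (6 * d) ^ DIM('a) * \<delta> ^ DIM('a)"
        by (simp only: power_mult_distrib[symmetric])
      then show ?thesis by (simp only: mT mult_ac)
    qed
    also have "\<dots> \<le> (6 * d) ^ DIM('a) * (2 ^ DIM('a) * V)"
      using cardN d1 by (intro mult_left_mono) auto
    also have "\<dots> = V * (6 * d * 2) ^ DIM('a)"
      by (simp only: power_mult_distrib mult_ac)
    also have "\<dots> = V * (12 * d) ^ DIM('a)" by simp
    finally show ?thesis .
  qed
  \<comment> \<open>chosen such that \<open>exp (- \<mu> / 2)\<close> cancels \<open>k 2\<^sup>k\<close> and the size \<open>(12 d)\<^sup>d V / v\<close> of the net\<close>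
  define \<mu> where "\<mu> = 2 * (d * ln (12 * d) + real k * ln 2 + ln (real k))"
  have mu0: "0 \<le> \<mu>" using d1 \<open>1 \<le> k\<close> by (simp add: \<mu>_def)
  define p where "p = measure lebesgue C / measure lebesgue B"
  have p: "v / 2 \<le> p * V" "p \<le> 1" "0 < p"
  proof -
    have "1 + real DIM('a) * (- \<delta>) \<le> (1 + (- \<delta>)) ^ DIM('a)"
      using \<delta> by (intro Bernoulli_inequality) auto
    then have "1/2 \<le> (1 - \<delta>) ^ DIM('a)" using d1 by (simp add: \<delta>_def d_def)
    then have "1/2 * v \<le> measure lebesgue C"
      unfolding mC using v0 by (intro mult_right_mono) auto
    then show "v / 2 \<le> p * V" "0 < p" using V0 v0 by (auto simp: p_def V_def)
    show "p \<le> 1" using CB V0 by (simp add: p_def V_def)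
  qed
  \<comment> \<open>Enough rounds for \<open>(1 - p / 2) ^ M \<le> exp (- (p * M / 2)) \<le> exp (-
    (\<mu> / 2))\<close>; rounding up costs at most one further translate.\<close>
  define M where "M = nat \<lceil>\<mu> / p\<rceil>"
  have M: "\<mu> / p \<le> real M" "real M \<le> \<mu> / p + 1"
    using mu0 p ceiling_correct[of "\<mu> / p"] by (auto simp: M_def real_nat_ceiling_ge)
  have NC: "n - c \<in> B" if "n \<in> N" "c \<in> C" for n c
    using QB[of n "- c"] CR[OF that(2)] N(1) that(1) by auto
  have "\<exists>ts. (\<forall>n\<in>N. k \<le> length (filter (\<lambda>t. n - t \<in> C) ts)) \<and>
      real (length ts) \<le> real M + real k * 2 ^ k * (1 - p / 2) ^ M * real (card N)"
    unfolding p_def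
    by (rule exists_kfold_cover_of_finite_set[OF N(2) C(1) Bm V0[unfolded V_def] CB _ C(2)]) (rule NC)
  then obtain ts where cov: "\<forall>n\<in>N. k \<le> length (filter (\<lambda>t. n - t \<in> C) ts)"
    and len: "real (length ts) \<le> real M + real k * 2 ^ k * (1 - p / 2) ^ M * real (card N)"
    by (elim exE conjE)
  have "k \<le> length (filter (\<lambda>t. x - t \<in> K) ts)" if xQ: "x \<in> Q" for x
  proof -
    obtain n where n: "n \<in> N" "x - n \<in> T" using net xQ by blast
    \<comment> \<open>\<open>x - t\<close> is the convex combination with weights
      \<open>1 - \<delta>\<close> and \<open>\<delta>\<close> of the points of \<open>K\<close> that
      witness \<open>n - t \<in> C\<close> and \<open>x - n \<in> T\<close>.\<close>
    have "x - t \<in> K" if nt: "n - t \<in> C" for t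
    proof -
      obtain y s where "y \<in> K" "n - t = (1 - \<delta>) *\<^sub>R y" "s \<in> K" "x - n = \<delta> *\<^sub>R s"
        using nt n(2) by (auto simp: C_def T_def S_def)
      moreover from this have "(1 - \<delta>) *\<^sub>R y + \<delta> *\<^sub>R s \<in> K"
        using K(2) \<delta> by (intro convexD) auto
      moreover have "x - t = (n - t) + (x - n)" by simp
      ultimately show ?thesis by (simp only:)
    qed
    then have "length (filter (\<lambda>t. n - t \<in> C) ts) \<le> length (filter (\<lambda>t. x - t \<in> K) ts)"
      by (induction ts) auto
    with cov n(1) show ?thesis by (meson order_trans)
  qed
  \<comment> \<open>Three contributions: \<open>2 * \<mu> * V\<close> from \<open>\<mu> / p\<close>
    rounds, because \<open>v \<le> 2 * p * V\<close>; at most \<open>V\<close> from rounding; at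
    most \<open>V\<close> from the repairs. Then \<open>V \<le> 2 * L ^ DIM('a)\<close> doubles
    everything.\<close>
  moreover have "real (length ts) * v \<le> L ^ DIM('a) * (4 * \<mu> + 4)"
  proof -
    have "1 - p / 2 \<le> exp (- (p / 2))"
      using exp_ge_add_one_self[of "- (p / 2)"] by simp
    then have "(1 - p / 2) ^ M \<le> exp (- (p / 2)) ^ M"
      using p by (intro power_mono) auto
    also have "\<dots> = exp (- (real M * p / 2))"
      by (simp add: exp_of_nat_mult[symmetric])
    also have "\<dots> \<le> exp (- (\<mu> / 2))"
    proof -
      have "\<mu> \<le> real M * p" using M(1) p(3) by (simp add: pos_divide_le_eq)
      then show ?thesis by simp
    qed
    also have "\<dots> = 1 / (real k * 2 ^ k * (12 * d) ^ DIM('a))"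
    proof -
      have "exp (\<mu> / 2) = exp (real DIM('a) * ln (12 * d)) * exp (real k * ln 2) * exp (ln (real k))"
        unfolding \<mu>_def exp_add[symmetric] d_def by simp
      also have "\<dots> = (12 * d) ^ DIM('a) * 2 ^ k * real k"
        unfolding exp_of_nat_mult using d1 \<open>1 \<le> k\<close> by simp
      finally show ?thesis
        unfolding exp_minus by (simp add: inverse_eq_divide mult_ac)
    qed
    finally have one: "(1 - p / 2) ^ M * (real k * 2 ^ k * (12 * d) ^ DIM('a)) \<le> 1"
      using d1 \<open>1 \<le> k\<close> by (simp add: pos_le_divide_eq)
    have "real k * 2 ^ k * (1 - p / 2) ^ M * real (card N) * v
       \<le> real k * 2 ^ k * (1 - p / 2) ^ M * (V * (12 * d) ^ DIM('a))"
      using cardN' p unfolding mult.assoc by (intro mult_left_mono) auto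
    also have "\<dots> = (1 - p / 2) ^ M * (real k * 2 ^ k * (12 * d) ^ DIM('a)) * V" by simp
    also have "\<dots> \<le> 1 * V"
      using one V0 by (intro mult_right_mono) auto
    finally have tail: "real k * 2 ^ k * (1 - p / 2) ^ M * real (card N) * v \<le> V" by simp
    have "\<mu> / p * v \<le> \<mu> / p * (2 * (p * V))"
      using p mu0 by (intro mult_left_mono) auto
    also have "\<dots> = 2 * \<mu> * V" using p by simp
    finally have "real M * v \<le> 2 * \<mu> * V + V"
      using mult_right_mono[OF M(2), of v] v0 vV by (simp add: algebra_simps)
    then have "real (length ts) * v \<le> V * (2 * \<mu> + 2)"
      using mult_right_mono[OF len, of v] tail v0 by (simp add: algebra_simps)
    also have "\<dots> \<le> (2 * L ^ DIM('a)) * (2 * \<mu> + 2)"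
      using VL mu0 by (intro mult_right_mono) auto
    finally show ?thesis by (simp add: algebra_simps)
  qed
  ultimately show ?thesis
    using L unfolding Q_def v_def \<mu>_def d_def
    by (intro exI[of _ L] conjI exI[of _ ts] ballI) (simp_all add: algebra_simps)
qed

text \<open>Removes the centring hypothesis: moving \<open>a / 2\<close> to the origin turns the
  overlap of \<open>K\<close> with \<open>a - K\<close> into that of \<open>K'\<close> with
  \<open>- K'\<close>. Shifting the translation vectors by \<open>- c\<close> leads back to
  \<open>K\<close>.\<close>

lemma exists_kfold_cover_of_cube:
  fixes K :: "'a::euclidean_space set"
  assumes K: "compact K" "convex K" "0 < measure lebesgue K" and "1 \<le> k"
  shows "\<exists>L>0. \<exists>ts. (\<forall>x\<in>cbox 0 (L *\<^sub>R One). k \<le> length (filter (\<lambda>t. x - t \<in> K) ts)) \<and>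
    real (length ts) * measure lebesgue K \<le> L ^ DIM('a) *
      (8 * (real DIM('a) * ln (12 * real DIM('a)) + real k * ln 2 + ln (real k)) + 4)"
proof -
  obtain a where a: "measure lebesgue K \<le> 3 ^ DIM('a) * measure lebesgue (K \<inter> (\<lambda>x. a - x) ` K)"
    using exists_large_reflection_overlap[OF K] by blast
  define c where "c = (1/2) *\<^sub>R a"
  define K' where "K' = (+) (- c) ` K"
  have ac: "a = c + c" by (simp add: c_def flip: scaleR_add_left)
  have mem: "x \<in> K' \<longleftrightarrow> x + c \<in> K" for x
    by (auto simp: K'_def image_iff intro: bexI[of _ "x + c"])
  have "K' \<inter> uminus ` K' = (+) (- c) ` (K \<inter> (\<lambda>x. a - x) ` K)"
  proof (intro set_eqI)
    fix x
    have "x \<in> uminus ` K' \<longleftrightarrow> - x \<in> K'" by (metis image_iff minus_minus)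
    moreover have "x \<in> (+) (- c) ` X \<longleftrightarrow> x + c \<in> X" for X
      by (auto simp: image_iff intro: bexI[of _ "x + c"])
    moreover have "x + c \<in> (\<lambda>x. a - x) ` K \<longleftrightarrow> - x + c \<in> K"
      by (auto simp: image_iff ac algebra_simps intro: bexI[of _ "c - x"])
    ultimately show "x \<in> K' \<inter> uminus ` K' \<longleftrightarrow> x \<in> (+) (- c) ` (K \<inter> (\<lambda>x. a - x) ` K)"
      by (simp add: mem)
  qed
  then have ov: "measure lebesgue K' \<le> 3 ^ DIM('a) * measure lebesgue (K' \<inter> uminus ` K')"
    using a by (simp only: K'_def measure_translation)
  have mK': "measure lebesgue K' = measure lebesgue K"
    unfolding K'_def by (rule measure_translation)
  have "compact K'" "convex K'" "0 < measure lebesgue K'"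
    using K(3) mK' compact_translation[OF K(1)] convex_translation[OF K(2)] unfolding K'_def by metis+
  from exists_kfold_cover_of_cube_centred[OF this ov \<open>1 \<le> k\<close>]
  obtain L ts where L: "L > 0" and ts: "\<And>x. x \<in> cbox 0 (L *\<^sub>R One) \<Longrightarrow> k \<le> length (filter (\<lambda>t. x - t \<in> K') ts)"
    and len: "real (length ts) * measure lebesgue K \<le> L ^ DIM('a) *
      (8 * (real DIM('a) * ln (12 * real DIM('a)) + real k * ln 2 + ln (real k)) + 4)"
    unfolding mK' by blast
  have "k \<le> length (filter (\<lambda>t. x - t \<in> K) (map (\<lambda>t. t - c) ts))" if "x \<in> cbox 0 (L *\<^sub>R One)" for x
    using ts[OF that] by (simp add: filter_map comp_def mem diff_diff_eq2 diff_add_eq)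
  then show ?thesis
    using L len by (intro exI[of _ L] conjI exI[of _ "map (\<lambda>t. t - c) ts"]) auto
qed

section \<open>Periodic extension and its density\<close>

lemma mem_translate_iff: "x \<in> translate t K \<longleftrightarrow> x - t \<in> K"
  by (force simp: translate_def image_iff algebra_simps)

text \<open>The cover is repeated along the lattice \<open>Z\<close> of multiples of
  \<open>L\<close>. A translate inside the ball of radius \<open>r\<close> has its lattice cell
  inside radius \<open>r + c\<close> with \<open>c\<close> fixed, so packing cells bounds the count,
  and the excess \<open>(1 + c / r) ^ DIM('a)\<close> tends to 1.\<close>

lemma kfold_covering_density_le_of_cube_cover:
  fixes K :: "'a::euclidean_space set" and ts :: "'a list"
  assumes K: "compact K" "K \<noteq> {}" and "0 < L" "1 \<le> k"
    and cover: "\<And>x. x \<in> cbox 0 (L *\<^sub>R One) \<Longrightarrow> k \<le> length (filter (\<lambda>t. x - t \<in> K) ts)"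
  shows "kfold_covering_density k K \<le> ereal (real (length ts) * measure lebesgue K / L ^ DIM('a))"
proof -
  define n where "n = length ts"
  define Z :: "'a set" where "Z = {z. \<forall>i\<in>Basis. \<exists>m::int. z \<bullet> i = L * of_int m}"
  \<comment> \<open>A nonempty list makes the index set below infinite, hence in bijection with the
    natural numbers.\<close>
  have "n > 0"
  proof -
    have "(0::'a) \<in> cbox 0 (L *\<^sub>R One)" using \<open>0 < L\<close> by (auto simp: mem_box)
    from cover[OF this] \<open>1 \<le> k\<close> show ?thesis
      by (metis n_def filter.simps(1) length_0_conv not_gr_zero not_one_le_zero le_zero_eq)
  qed
  have "countable Z"
  proof (rule countable_subset)
    show "Z \<subseteq> (\<lambda>f. \<Sum>i\<in>Basis. f i *\<^sub>R i) ` (Basis \<rightarrow>\<^sub>E range (\<lambda>m::int. L * of_int m))"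
    proof
      fix z assume "z \<in> Z"
      then have "restrict (\<lambda>i. z \<bullet> i) Basis \<in> Basis \<rightarrow>\<^sub>E range (\<lambda>m::int. L * of_int m)"
        by (auto simp: Z_def)
      moreover have "z = (\<Sum>i\<in>Basis. restrict (\<lambda>i. z \<bullet> i) Basis i *\<^sub>R i)"
        by (simp add: euclidean_representation)
      ultimately show "z \<in> (\<lambda>f. \<Sum>i\<in>Basis. f i *\<^sub>R i) ` (Basis \<rightarrow>\<^sub>E range (\<lambda>m::int. L * of_int m))"
        by blast
    qed
  qed (auto intro!: countable_image countable_PiE)
  \<comment> \<open>Indexing by list positions instead of vectors preserves the multiplicity of
    repeated translates.\<close>
  define I where "I = {..<n} \<times> Z"
  have "countable I" using \<open>countable Z\<close> by (simp add: I_def)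
  have "infinite I"
  proof -
    obtain b :: 'a where b: "b \<in> Basis" using nonempty_Basis by blast
    have "inj (\<lambda>m::nat. (0::nat, (L * real m) *\<^sub>R b))"
      using b \<open>0 < L\<close> by (auto simp: inj_on_def)
    moreover have "range (\<lambda>m::nat. (0::nat, (L * real m) *\<^sub>R b)) \<subseteq> I"
      using b \<open>n > 0\<close> by (force simp: I_def Z_def inner_Basis intro: exI[of _ "int m" for m] exI[of _ 0])
    ultimately show ?thesis
      by (meson finite_subset range_inj_infinite)
  qed
  define e where "e = from_nat_into I"
  have e: "bij_betw e UNIV I"
    unfolding e_def using \<open>countable I\<close> \<open>infinite I\<close> by (rule bij_betw_from_nat_into)
  define g where "g = the_inv_into UNIV e"
  have eg: "e (g p) = p" if "p \<in> I" for p
    unfolding g_def using e that by (rule f_the_inv_into_f_bij_betw)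
  define t where "t m = ts ! fst (e m) + snd (e m)" for m
  have "kfold_translative_covering k K t"
    unfolding kfold_translative_covering_def
  proof
    fix x :: 'a
    \<comment> \<open>The lower corner of the lattice cell containing \<open>x\<close>; the given
      cover is applied to \<open>x - z\<close>.\<close>
    define z :: 'a where "z = (\<Sum>i\<in>Basis. (L * of_int \<lfloor>x \<bullet> i / L\<rfloor>) *\<^sub>R i)"
    have z_i: "z \<bullet> i = L * of_int \<lfloor>x \<bullet> i / L\<rfloor>" if "i \<in> Basis" for i
      using that by (simp add: z_def)
    have "z \<in> Z" using z_i by (auto simp: Z_def)
    have "x - z \<in> cbox 0 (L *\<^sub>R One)"
    proof -
      have "0 \<le> (x - z) \<bullet> i \<and> (x - z) \<bullet> i \<le> L" if "i \<in> Basis" for i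
      proof -
        have "(x - z) \<bullet> i = L * frac (x \<bullet> i / L)"
          using \<open>0 < L\<close> z_i[OF that] by (simp add: frac_def inner_diff_left algebra_simps)
        moreover have "L * frac (x \<bullet> i / L) \<le> L * 1"
          using \<open>0 < L\<close> frac_lt_1[of "x \<bullet> i / L"] by (intro mult_left_mono) auto
        ultimately show ?thesis using \<open>0 < L\<close> by simp
      qed
      then show ?thesis by (simp add: mem_box)
    qed
    then have "k \<le> card {j. j < length ts \<and> (x - z) - ts ! j \<in> K}"
      using cover by (simp add: length_filter_conv_card)
    then obtain J where J: "J \<subseteq> {j. j < length ts \<and> (x - z) - ts ! j \<in> K}" "card J = k" "finite J"
      by (meson obtain_subset_with_card_n)
    have JI: "J \<times> {z} \<subseteq> I" using J(1) \<open>z \<in> Z\<close> by (auto simp: I_def n_def)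
    have "inj_on g (J \<times> {z})"
      by (rule inj_on_inverseI[of _ e]) (use JI eg in blast)
    then have "card (g ` (J \<times> {z})) = k"
      using J by (simp add: card_image card_cartesian_product)
    moreover have "g ` (J \<times> {z}) \<subseteq> {i. x \<in> translate (t i) K}"
    proof
      fix i assume "i \<in> g ` (J \<times> {z})"
      then obtain j where j: "j \<in> J" "i = g (j, z)" by auto
      then have "e i = (j, z)" using JI eg by blast
      then show "i \<in> {i. x \<in> translate (t i) K}"
        using j J(1) by (auto simp: mem_translate_iff t_def algebra_simps)
    qed
    ultimately show "\<exists>F. F \<subseteq> {i. x \<in> translate (t i) K} \<and> finite F \<and> card F = k"
      using J(3) by blast
  qed
  then have "kfold_covering_density k K \<le> translative_density K t"
    unfolding kfold_covering_density_def by (intro Inf_lower) auto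
  also have "\<dots> \<le> ereal (real n * measure lebesgue K / L ^ DIM('a))"
  proof -
    obtain x0 where "x0 \<in> K" using K by blast
    obtain b where b: "\<And>q. q \<in> cbox 0 (L *\<^sub>R One :: 'a) \<Longrightarrow> norm q \<le> b"
      using bounded_cbox unfolding bounded_iff by blast
    \<comment> \<open>Bounds the distance from any point of the cell at \<open>z\<close> to the
      point \<open>ts ! j + z + x0\<close> of the translate, uniformly in \<open>j\<close> and
      \<open>z\<close>.\<close>
    define c where "c = b + (\<Sum>j<n. norm (ts ! j)) + norm x0"
    have "0 \<in> cbox 0 (L *\<^sub>R One :: 'a)" using \<open>0 < L\<close> by (auto simp: mem_box)
    then have "0 \<le> b" using b by fastforce
    then have "0 \<le> c" by (auto simp: c_def intro!: add_nonneg_nonneg sum_nonneg)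
    define w where "w = unit_ball_vol (real DIM('a))"
    have "w > 0" by (simp add: w_def)
    \<comment> \<open>Open cells are pairwise disjoint and have the same volume as the closed
      cube.\<close>
    have mbox: "measure lebesgue (box 0 (L *\<^sub>R One :: 'a)) = L ^ DIM('a)"
      using \<open>0 < L\<close> by (simp add: measure_lborel_box_eq)
    have count: "count_inside K t r \<le> ereal (real n * (w * (r + c) ^ DIM('a)) / L ^ DIM('a))"
      if "r > 0" for r
    proof -
      define S where "S = {i. translate (t i) K \<subseteq> cball 0 r}"
      define Y where "Y = {z \<in> Z. (+) z ` box 0 (L *\<^sub>R One) \<subseteq> cball 0 (r + c)}"
      have "finite Y \<and> real (card Y) * measure lebesgue (box 0 (L *\<^sub>R One :: 'a)) \<le> measure lebesgue (cball (0::'a) (r + c))"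
      proof (rule packing_card_le)
        show "pairwise (\<lambda>x y. disjnt ((+) x ` box 0 (L *\<^sub>R One)) ((+) y ` box 0 (L *\<^sub>R One))) Y"
        proof (rule pairwiseI)
          fix y y' assume yy: "y \<in> Y" "y' \<in> Y" "y \<noteq> y'"
          then obtain i where i: "i \<in> Basis" "y \<bullet> i \<noteq> y' \<bullet> i"
            by (meson euclidean_eqI)
          obtain m m' :: int where m: "y \<bullet> i = L * m" "y' \<bullet> i = L * m'"
            using yy i(1) unfolding Y_def Z_def by blast
          have False if "q \<in> box 0 (L *\<^sub>R One)" "q' \<in> box 0 (L *\<^sub>R One)" "y + q = y' + q'" for q q'
          proof -
            have "0 < q \<bullet> i" "q \<bullet> i < L" "0 < q' \<bullet> i" "q' \<bullet> i < L"
              using that i(1) by (auto simp: mem_box)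
            moreover have "L * m + q \<bullet> i = L * m' + q' \<bullet> i"
              using arg_cong[OF that(3), of "\<lambda>x. x \<bullet> i"] m by (simp add: inner_add_left)
            ultimately have "L * (real_of_int m - m') < L * 1" "L * (-1) < L * (real_of_int m - m')"
              by (auto simp: algebra_simps)
            then have "real_of_int m - m' < 1" "-1 < real_of_int m - m'"
              using \<open>0 < L\<close> by (simp_all only: mult_less_cancel_left_pos)
            then have "m = m'" by linarith
            with i m show False by simp
          qed
          then show "disjnt ((+) y ` box 0 (L *\<^sub>R One)) ((+) y' ` box 0 (L *\<^sub>R One))"
            by (auto simp: disjnt_iff)
        qed
      qed (use \<open>0 < L\<close> mbox in \<open>auto simp: Y_def\<close>)
      then have Y: "finite Y" "real (card Y) * L ^ DIM('a) \<le> w * (r + c) ^ DIM('a)"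
        using \<open>0 \<le> c\<close> \<open>r > 0\<close> unfolding mbox by (auto simp: content_cball w_def)
      have "e ` S \<subseteq> {..<n} \<times> Y"
      proof
        fix p assume "p \<in> e ` S"
        then obtain i where i: "i \<in> S" "p = e i" by blast
        have "p \<in> I" using e i by (auto simp: bij_betw_def)
        then obtain j z where p: "p = (j, z)" "j < n" "z \<in> Z" by (auto simp: I_def)
        have "e i = (j, z)" using i p by simp
        then have "ts ! j + z + x0 \<in> translate (t i) K"
          using \<open>x0 \<in> K\<close> by (simp add: mem_translate_iff t_def)
        then have le: "norm (ts ! j + z + x0) \<le> r"
          using i by (auto simp: S_def)
        have "norm (ts ! j) \<le> (\<Sum>j<n. norm (ts ! j))"
          using p(2) by (intro member_le_sum) auto
        have "norm (z + q) \<le> r + c" if "q \<in> box 0 (L *\<^sub>R One)" for q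
        proof -
          have "norm q \<le> b" using b that box_subset_cbox by blast
          moreover have "z + q = (ts ! j + z + x0) + (q - ts ! j - x0)" by simp
          then have "norm (z + q) \<le> norm (ts ! j + z + x0) + norm (q - ts ! j - x0)"
            by (metis norm_triangle_ineq)
          moreover have "norm (q - ts ! j - x0) \<le> norm q + norm (ts ! j) + norm x0"
            by (meson norm_triangle_ineq4 order_trans add_right_mono)
          ultimately show ?thesis
            using le \<open>norm (ts ! j) \<le> _\<close> unfolding c_def by linarith
        qed
        then show "p \<in> {..<n} \<times> Y" using p by (auto simp: Y_def)
      qed
      moreover have inj: "inj_on e S" using e by (auto simp: bij_betw_def inj_on_def)
      \<comment> \<open>Finiteness also excludes the value \<open>\<infinity>\<close> in
        \<open>count_inside\<close>.\<close>
      ultimately have "finite S" "card S \<le> n * card Y"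
        using Y(1) card_inj_on_le[of e S "{..<n} \<times> Y"] inj_on_finite[of e S "{..<n} \<times> Y"]
        by (auto simp: card_cartesian_product)
      then have "real (card S) \<le> real n * real (card Y)"
        by (metis of_nat_le_iff of_nat_mult)
      also have "\<dots> \<le> real n * (w * (r + c) ^ DIM('a) / L ^ DIM('a))"
        using Y(2) \<open>0 < L\<close> by (intro mult_left_mono) (auto simp: field_simps)
      finally show ?thesis
        using \<open>finite S\<close> by (simp add: count_inside_def S_def[symmetric] Let_def)
    qed
    have "translative_density K t
        \<le> Limsup at_top (\<lambda>r. ereal (real n * measure lebesgue K / L ^ DIM('a) * (1 + c / r) ^ DIM('a)))"
      unfolding translative_density_def
    proof (rule Limsup_mono, rule eventually_mono[OF eventually_gt_at_top[of 0]])
      fix r :: real assume "r > 0"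
      have mK: "measure lborel K = measure lebesgue K" using K by (simp add: borel_compact)
      have mr: "measure lborel (cball (0::'a) r) = w * r ^ DIM('a)"
        using \<open>r > 0\<close> by (simp add: content_cball w_def)
      have "count_inside K t r * ereal (measure lborel K) / ereal (measure lborel (cball (0::'a) r))
          \<le> ereal (real n * (w * (r + c) ^ DIM('a)) / L ^ DIM('a)) * ereal (measure lborel K)
            / ereal (measure lborel (cball (0::'a) r))"
        using count[OF \<open>r > 0\<close>] \<open>r > 0\<close> \<open>w > 0\<close> unfolding mr
        by (intro ereal_divide_right_mono ereal_mult_right_mono) auto
      also have "\<dots> = ereal (real n * (w * (r + c) ^ DIM('a)) / L ^ DIM('a) * measure lebesgue K / (w * r ^ DIM('a)))"
        unfolding mr mK using \<open>r > 0\<close> \<open>w > 0\<close> by simp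
      also have "real n * (w * (r + c) ^ DIM('a)) / L ^ DIM('a) * measure lebesgue K / (w * r ^ DIM('a))
          = real n * measure lebesgue K / L ^ DIM('a) * ((r + c) / r) ^ DIM('a)"
        using \<open>r > 0\<close> \<open>w > 0\<close> \<open>0 < L\<close> by (simp add: power_divide field_simps)
      also have "(r + c) / r = 1 + c / r" using \<open>r > 0\<close> by (simp add: field_simps)
      finally show "count_inside K t r * ereal (measure lborel K) / ereal (measure lborel (cball (0::'a) r))
          \<le> ereal (real n * measure lebesgue K / L ^ DIM('a) * (1 + c / r) ^ DIM('a))" .
    qed
    also have "\<dots> = ereal (real n * measure lebesgue K / L ^ DIM('a))"
    proof (rule lim_imp_Limsup)
      have "((\<lambda>r. c / r) \<longlongrightarrow> 0) at_top"
        by (intro tendsto_divide_0[OF tendsto_const] filterlim_at_top_imp_at_infinity filterlim_ident)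
      then have "((\<lambda>r. real n * measure lebesgue K / L ^ DIM('a) * (1 + c / r) ^ DIM('a)) \<longlongrightarrow>
          real n * measure lebesgue K / L ^ DIM('a) * (1 + 0) ^ DIM('a)) at_top"
        by (intro tendsto_intros)
      then show "((\<lambda>r. ereal (real n * measure lebesgue K / L ^ DIM('a) * (1 + c / r) ^ DIM('a))) \<longlongrightarrow>
          ereal (real n * measure lebesgue K / L ^ DIM('a))) at_top"
        by simp
    qed simp
    finally show ?thesis .
  qed
  finally show ?thesis by (simp add: n_def)
qed

section \<open>The numerical constants\<close>

theorem theorem1p3:
  fixes K :: "'a::euclidean_space set" and k :: nat
  assumes "DIM('a) \<ge> 2"
    and "convex_body K"
    and "k \<ge> 1"
    and "real k \<le> real DIM('a) * (ln (real DIM('a)) + ln (ln (real DIM('a))))"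
  shows "kfold_covering_density k K
           \<le> ereal (6 * exp 1 * real DIM('a) *
                    (3 * ln (real DIM('a)) + ln (ln (real DIM('a))) + 15))"
proof -
  define d where "d = real DIM('a)"
  have "d \<ge> 2" using assms(1) by (simp add: d_def)
  have K: "compact K" "convex K" "interior K \<noteq> {}"
    using assms(2) by (auto simp: convex_body_def)
  then have "0 < measure lebesgue K"
    by (metis lmeasurable_compact negligible_convex_interior negligible_iff_measure zero_less_measure_iff)
  then obtain L ts where "L > 0"
    and cover: "\<forall>x\<in>cbox 0 (L *\<^sub>R One). k \<le> length (filter (\<lambda>t. x - t \<in> K) ts)"
    and len: "real (length ts) * measure lebesgue K \<le> L ^ DIM('a) *
      (8 * (d * ln (12 * d) + real k * ln 2 + ln (real k)) + 4)"
    using exists_kfold_cover_of_cube[OF K(1,2) _ assms(3)] unfolding d_def by blast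
  have "kfold_covering_density k K \<le> ereal (real (length ts) * measure lebesgue K / L ^ DIM('a))"
    using K \<open>L > 0\<close> assms(3) cover interior_subset[of K]
    by (intro kfold_covering_density_le_of_cube_cover) auto
  also have "\<dots> \<le> ereal (8 * (d * ln (12 * d) + real k * ln 2 + ln (real k)) + 4)"
    using len \<open>L > 0\<close> by (simp add: field_simps)
  also have "\<dots> \<le> ereal (6 * exp 1 * d * (3 * ln d + ln (ln d) + 15))"
  proof -
    define X where "X = ln d + ln (ln d)"
    have kX: "real k \<le> d * X" using assms(4) by (simp add: d_def X_def)
    \<comment> \<open>Used twice: \<open>6 * (5 / 2) = 15\<close> matches the coefficient reached
      below, and \<open>(5 / 2) ^ 3 > 12\<close> bounds \<open>ln 12\<close> by 3.\<close>
    have e: "5 / 2 \<le> exp (1::real)"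
      using exp_lower_Taylor_quadratic[of "1::real"] by simp
    have "12 \<le> exp (3::real)"
      using power_mono[OF e, of 3] exp_of_nat_mult[of 3 "1::real"] by (simp add: power3_eq_cube)
    then have "ln 12 \<le> (3::real)"
      by (metis exp_gt_zero ln_exp ln_le_cancel_iff zero_less_numeral)
    then have "d * ln (12 * d) \<le> d * (3 + ln d)"
      using \<open>d \<ge> 2\<close> by (intro mult_left_mono) (auto simp: ln_mult)
    moreover have "real k * ln 2 \<le> real k * (25 / 36)"
      using ln2_le_25_over_36 by (intro mult_left_mono) auto
    moreover have "ln (real k) \<le> real k"
      using ln_le_minus_one[of "real k"] assms(3) by simp
    \<comment> \<open>Since \<open>8 * (25 / 36 + 1) < 15\<close>, the terms in \<open>k\<close> are
      at most \<open>15 * k \<le> 15 * (d * X)\<close>.\<close>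
    ultimately have "8 * (d * ln (12 * d) + real k * ln 2 + ln (real k)) + 4
        \<le> 15 * (d * X) + 8 * (d * ln d) + 24 * d + 4"
      using kX by (simp add: algebra_simps)
    also have "\<dots> \<le> 15 * (d * X) + 30 * (d * ln d) + 225 * d"
    proof -
      have "0 \<le> d * ln d" using \<open>d \<ge> 2\<close> by simp
      then show ?thesis using \<open>d \<ge> 2\<close> by linarith
    qed
    also have "\<dots> = 15 * (d * (X + 2 * ln d + 15))"
      by (simp add: algebra_simps)
    also have "\<dots> \<le> 6 * exp 1 * (d * (X + 2 * ln d + 15))"
    proof (rule mult_right_mono)
      \<comment> \<open>As \<open>ln (ln d)\<close> is negative for \<open>d = 2\<close>, the sign
        of \<open>X\<close> is read off from \<open>1 \<le> k \<le> d * X\<close>.\<close>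
      have "0 \<le> X" using kX assms(3) \<open>d \<ge> 2\<close> by (smt (verit) mult_nonneg_nonpos of_nat_0_le_iff of_nat_1 of_nat_mono)
      then show "0 \<le> d * (X + 2 * ln d + 15)" using \<open>d \<ge> 2\<close> by simp
    qed (use e in simp)
    also have "X + 2 * ln d = 3 * ln d + ln (ln d)" by (simp add: X_def)
    finally show ?thesis by (simp add: mult.assoc)
  qed
  finally show ?thesis by (simp add: d_def)
qed

end
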